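(* Let $\{A_k\}$ be a finite or countable family of Borel subsets of $\mathbb{R}^d$ such that $$\sup_n \dim_{\mathrm{FM}}\Big(A_n \cap \overline{\bigcup_{k\neq n} A_k}\Big) < \dim_{\mathrm{F}}\Big(\bigcup_k A_k\Big).$$ Then $$\dim_{\mathrm{F}}\Big(\bigcup_k A_k\Big) = \sup_k \dim_{\mathrm{F}} A_k.$$
   Context: For a finite Borel measure $\mu$ on $\mathbb{R}^d$, $\widehat\mu(\xi)=\int e^{-2\pi i \xi\cdot x}\,d\mu(x)$ for $\xi\in\mathbb{R}^d$. The notation $f(\xi)\lesssim g(\xi)$ means there is a constant $C$ with $|f(\xi)|\le C|g(\xi)|$ for all $\xi$ (negative powers of $|\xi|$ are read as $+\infty$ at $\xi=0$). The Fourier dimension of $\mu$ is $\dim_{\mathrm{F}}\mu=\sup\{s\in[0,d]:\ \widehat\mu(\xi)\lesssim|\xi|^{-s/2}\}$. For a Borel set $A\subset\mathbb{R}^d$, $\mathcal{P}(A)$ is the set of Borel probability measures $\mu$ on $\mathbb{R}^d$ with $\mu(A)=1$. The Fourier dimension of $A$ is $\dim_{\mathrm{F}}A=\sup\{\dim_{\mathrm{F}}\mu:\ \mu\in\mathcal{P}(A)\}$, and the modified Fourier dimension of $A$ is $\dim_{\mathrm{FM}}A=\sup\{\dim_{\mathrm{F}}\mu:\ \mu\in\mathcal{P}(\mathbb{R}^d),\ \mu(A)>0\}$. Suprema of empty sets of dimensions are $0$. The bar denotes topological closure in $\mathbb{R}^d$. *)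

theory Defs
  imports "HOL-Probability.Probability"
begin

definition fourier_transform :: "'a::euclidean_space measure \<Rightarrow> 'a \<Rightarrow> complex" where
  "fourier_transform \<mu> \<xi> =
     (LINT x|\<mu>. exp (- 2 * complex_of_real pi * \<i> * complex_of_real (\<xi> \<bullet> x)))"

text \<open>
  The point \<open>\<xi> = 0\<close> is left out because it imposes no condition. For \<open>s > 0\<close> the right-hand side
  is read as \<open>+\<infinity>\<close> there, and for \<open>s = 0\<close> it is read as \<open>C\<close>, which can be enlarged. In the library,
  \<open>0 powr a = 0\<close> for every \<open>a\<close>.
\<close>
definition fourier_decay :: "'a::euclidean_space measure \<Rightarrow> real \<Rightarrow> bool" where
  "fourier_decay \<mu> s \<longleftrightarrow>
     (\<exists>C::real. \<forall>\<xi>. \<xi> \<noteq> 0 \<longrightarrow> cmod (fourier_transform \<mu> \<xi>) \<le> C * norm \<xi> powr (- s / 2))"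

text \<open>
  Dimensions take values in \<^typ>\<open>ennreal\<close>, where every set has a supremum and the supremum of
  the empty set is \<open>0\<close>. All of them are bounded by the dimension of the ambient space.
\<close>
definition fourier_dim_measure :: "'a::euclidean_space measure \<Rightarrow> ennreal" where
  "fourier_dim_measure \<mu> = (SUP s\<in>{s. 0 \<le> s \<and> s \<le> real DIM('a) \<and> fourier_decay \<mu> s}. ennreal s)"

definition borel_probs :: "'a::euclidean_space set \<Rightarrow> 'a measure set" where
  "borel_probs A = {\<mu>. sets \<mu> = sets borel \<and> prob_space \<mu> \<and> emeasure \<mu> A = 1}"

definition fourier_dim :: "'a::euclidean_space set \<Rightarrow> ennreal" where
  "fourier_dim A = (SUP \<mu>\<in>borel_probs A. fourier_dim_measure \<mu>)"

definition modified_fourier_dim :: "'a::euclidean_space set \<Rightarrow> ennreal" where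
  "modified_fourier_dim A =
     (SUP \<mu>\<in>{\<mu> \<in> borel_probs UNIV. emeasure \<mu> A > 0}. fourier_dim_measure \<mu>)"

end

theory Submission
  imports Defs
begin

text \<open>
  If \<open>\<mu>\<close> is carried by \<open>\<Union>\<^sub>k A\<^sub>k\<close> and its dimension exceeds the given supremum, then \<open>\<mu>\<close> is null
  on each \<open>A\<^sub>n \<inter> closure (\<Union>\<^sub>k\<^sub>\<noteq>\<^sub>n A\<^sub>k)\<close>. So some open \<open>U\<^sub>n = - closure (\<Union>\<^sub>k\<^sub>\<noteq>\<^sub>n A\<^sub>k)\<close> has positive measure,
  and there \<open>\<mu>\<close> lives on \<open>A\<^sub>n\<close>. Multiplying \<open>\<mu>\<close> by a bump function supported in \<open>U\<^sub>n\<close> gives a measure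
  carried by \<open>A\<^sub>n\<close> and does not destroy Fourier decay, because on the Fourier side it is a
  convolution with a rapidly decreasing function.

  The bump is a product of one-dimensional ones, so that only one-dimensional convolutions
  along coordinate directions occur. The one-dimensional bump is \<open>y \<mapsto> P(y - 1 < Y \<le> y + 1)\<close>, where \<open>Y\<close>
  is a sum of independent uniform variables; its Fourier representation is Levy's inversion formula.
\<close>

section \<open>Compactly supported laws with decaying characteristic functions\<close>

lemma real_distribution_uniform:
  assumes "r > 0"
  shows "real_distribution (uniform_measure lborel {-r..r})"
  using assms
  by (intro real_distribution.intro real_distribution_axioms.intro prob_space_uniform_measure) auto

text \<open>The integral is explicit, and the two endpoint values of the antiderivative contribute
  at most \<open>1 / \<bar>t\<bar>\<close> each. Stating the bound as a product also covers
  \<open>t = 0\<close>.\<close>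

lemma char_uniform_decay:
  assumes r: "r > 0"
  shows "cmod (char (uniform_measure lborel {-r..r}) t) * \<bar>t\<bar> \<le> 1 / r"
proof (cases "t = 0")
  case False
  have dens: "uniform_measure lborel {-r..r} =
      density lborel (\<lambda>x. ennreal (indicator {-r..r} x / (2 * r)))"
    unfolding uniform_measure_def using r
    by (intro density_cong)
      (auto simp: divide_ennreal indicator_def ennreal_1[symmetric] simp del: ennreal_1)
  have "char (uniform_measure lborel {-r..r}) t =
      (CLBINT x. (indicator {-r..r} x / (2 * r)) *\<^sub>R iexp (t * x))"
    unfolding char_def dens using r by (subst integral_density) auto
  also have "\<dots> = (CLBINT x. (1 / (2 * r)) *\<^sub>R (indicator {-r..r} x *\<^sub>R iexp (t * x)))"
    by (intro Bochner_Integration.integral_cong) (auto simp: indicator_def)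
  also have "\<dots> = (1 / (2 * r)) *\<^sub>R (CLBINT x:{-r..r}. iexp (t * x))"
    unfolding set_lebesgue_integral_def by (rule integral_scaleR_right)
  also have "(CLBINT x:{-r..r}. iexp (t * x)) = (CLBINT x=-r..r. iexp (t * x))"
    using r interval_integral_Icc[of "-r" r "\<lambda>x. iexp (t * x)"] by simp
  also have "\<dots> = iexp (t * r) / (\<i> * t) - iexp (t * (- r)) / (\<i> * t)"
  proof (rule interval_integral_FTC_finite)
    fix x
    have "((\<lambda>x. iexp (t * x) / (\<i> * t)) has_vector_derivative (t *\<^sub>R (\<i> * iexp (t * x))) / (\<i> * t))
        (at x within {min (- r) r..max (- r) r})"
      by (intro has_vector_derivative_divide vector_diff_chain_within[where g=iexp, unfolded o_def]
          has_vector_derivative_iexp) (auto intro!: derivative_eq_intros)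
    also have "(t *\<^sub>R (\<i> * iexp (t * x))) / (\<i> * t) = iexp (t * x)"
      using False by (simp add: scaleR_conv_of_real)
    finally show "((\<lambda>x. iexp (t * x) / (\<i> * t)) has_vector_derivative iexp (t * x))
        (at x within {min (- r) r..max (- r) r})" .
  qed (intro continuous_intros)
  finally have "cmod (char (uniform_measure lborel {-r..r}) t) =
      (1 / (2 * r)) * cmod (iexp (t * r) / (\<i> * t) - iexp (t * (- r)) / (\<i> * t))"
    using r by simp
  also have "\<dots> \<le> (1 / (2 * r)) * (1 / \<bar>t\<bar> + 1 / \<bar>t\<bar>)"
  proof (intro mult_left_mono order.trans[OF norm_triangle_ineq4] add_mono)
    show "cmod (iexp (t * r) / (\<i> * t)) \<le> 1 / \<bar>t\<bar>" "cmod (iexp (t * - r) / (\<i> * t)) \<le> 1 / \<bar>t\<bar>"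
      by (simp_all only: norm_divide norm_mult norm_exp_i_times norm_ii norm_of_real mult_1)
  qed (use r in simp)
  finally show ?thesis using r False by (simp add: field_simps)
qed (use r in simp)

text \<open>Each summand in a sum of \<open>n + 1\<close> independent uniform variables gains one
  power of \<open>\<bar>t\<bar>\<close>. The bounded range will fix the plateau and the support of
  the bump; the absence of atoms is what Levy inversion asks for at interval endpoints.\<close>

lemma exists_distribution_char_decay:
  assumes "r > 0"
  shows "\<exists>M C. real_distribution M \<and> (AE x in M. \<bar>x\<bar> \<le> r) \<and> (\<forall>a. AE x in M. x \<noteq> a) \<and>
    (\<forall>t. cmod (char M t) * \<bar>t\<bar> ^ Suc n \<le> C)"
  using assms
proof (induction n arbitrary: r)
  case 0
  let ?U = "uniform_measure lborel {-r..r}"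
  have 1: "AE x in ?U. \<bar>x\<bar> \<le> r"
    by (intro AE_uniform_measureI) auto
  have 2: "AE x in ?U. x \<noteq> a" for a
    using AE_lborel_singleton[of a] by (intro AE_uniform_measureI) auto
  have 3: "cmod (char ?U t) * \<bar>t\<bar> ^ Suc 0 \<le> 1 / r" for t
    using char_uniform_decay[OF 0, of t] by simp
  show ?case by (intro exI[of _ ?U] exI[of _ "1 / r"] conjI allI real_distribution_uniform[OF 0] 1 2 3)
next
  case (Suc n)
  \<comment> \<open>The range \<open>r\<close> is shared equally between the new uniform summand and
    the law from the induction hypothesis; this is why \<open>r\<close> is arbitrary in the
    induction.\<close>
  define U where "U = uniform_measure lborel {-(r/2)..r/2}"
  have U: "real_distribution U" unfolding U_def using Suc.prems by (intro real_distribution_uniform) simp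
  have U1: "AE x in U. \<bar>x\<bar> \<le> r / 2"
    unfolding U_def by (intro AE_uniform_measureI) auto
  have U2: "AE x in U. x \<noteq> a" for a
    unfolding U_def using AE_lborel_singleton[of a] by (intro AE_uniform_measureI) auto
  obtain M C where M: "real_distribution M" and M1: "AE x in M. \<bar>x\<bar> \<le> r / 2"
    and MC: "\<And>t. cmod (char M t) * \<bar>t\<bar> ^ Suc n \<le> C"
    using Suc.IH[of "r / 2"] Suc.prems by auto
  interpret M: real_distribution M by (rule M)
  interpret U: real_distribution U by (rule U)
  interpret P: pair_prob_space M U ..
  define N where "N = distr (M \<Otimes>\<^sub>M U) borel (\<lambda>(x, y). x + y)"
  have meas: "(\<lambda>(x, y). x + y) \<in> borel_measurable (M \<Otimes>\<^sub>M U)" by measurable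
  have N: "real_distribution N"
    unfolding N_def by (intro P.real_distribution_distr meas)
  have 1: "AE x in N. \<bar>x\<bar> \<le> r"
    unfolding N_def
  proof (subst AE_distr_iff[OF meas])
    have *: "AE x in M. AE y in U. \<bar>x + y\<bar> \<le> r"
      using M1
    proof eventually_elim
      case (elim x)
      show ?case using U1 by eventually_elim (use elim in linarith)
    qed
    have "{z \<in> space (M \<Otimes>\<^sub>M U). \<bar>case z of (x, y) \<Rightarrow> x + y\<bar> \<le> r} \<in> sets (M \<Otimes>\<^sub>M U)"
      by measurable
    then show "AE z in M \<Otimes>\<^sub>M U. \<bar>case z of (x, y) \<Rightarrow> x + y\<bar> \<le> r"
      by (rule P.AE_pair_measure) (use * in simp)
  qed simp
  \<comment> \<open>The uniform summand alone excludes atoms: for fixed \<open>x\<close>, the event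
    \<open>x + y = a\<close> is the single point \<open>y = a - x\<close>.\<close>
  have 2: "AE x in N. x \<noteq> a" for a
    unfolding N_def
  proof (subst AE_distr_iff[OF meas])
    have *: "AE x in M. AE y in U. x + y \<noteq> a"
    proof (rule AE_I2)
      fix x show "AE y in U. x + y \<noteq> a"
        using U2[of "a - x"] by eventually_elim auto
    qed
    have "{z \<in> space (M \<Otimes>\<^sub>M U). (case z of (x, y) \<Rightarrow> x + y) \<noteq> a} \<in> sets (M \<Otimes>\<^sub>M U)"
      by measurable
    then show "AE z in M \<Otimes>\<^sub>M U. (case z of (x, y) \<Rightarrow> x + y) \<noteq> a"
      by (rule P.AE_pair_measure) (use * in simp)
  qed simp
  have char: "char N t = char M t * char U t" for t
  proof -
    have int: "integrable (M \<Otimes>\<^sub>M U) (\<lambda>(x, y). iexp (t * x) * iexp (t * y))"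
      by (rule P.P.integrable_const_bound[where B=1]) (auto simp: norm_mult split_beta')
    have "char N t = (\<integral>z. (case z of (x, y) \<Rightarrow> iexp (t * x) * iexp (t * y)) \<partial>(M \<Otimes>\<^sub>M U))"
      unfolding char_def N_def
      by (subst integral_distr[OF meas]) (simp_all add: split_beta' exp_add distrib_left)
    also have "\<dots> = (\<integral>x. (\<integral>y. iexp (t * x) * iexp (t * y) \<partial>U) \<partial>M)"
      using P.integral_fst[OF int] by simp
    also have "\<dots> = char M t * char U t"
      by (simp add: char_def)
    finally show ?thesis .
  qed
  have 3: "cmod (char N t) * \<bar>t\<bar> ^ Suc (Suc n) \<le> C * (2 / r)" for t
  proof -
    have "cmod (char N t) * \<bar>t\<bar> ^ Suc (Suc n) =
        (cmod (char M t) * \<bar>t\<bar> ^ Suc n) * (cmod (char U t) * \<bar>t\<bar>)"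
      by (simp add: char norm_mult)
    also have "\<dots> \<le> C * (2 / r)"
    proof (rule mult_mono[OF MC])
      show "cmod (char U t) * \<bar>t\<bar> \<le> 2 / r"
        using char_uniform_decay[of "r / 2" t] Suc.prems unfolding U_def by simp
      show "0 \<le> C"
        by (rule order.trans[OF _ MC[of 0]]) simp
    qed simp
    finally show ?thesis .
  qed
  show ?case by (intro exI[of _ N] exI[of _ "C * (2 / r)"] conjI allI N 1 2 3)
qed

section \<open>A one-dimensional bump and its Fourier integral\<close>

lemma integrable_one_over_one_plus_square: "integrable lborel (\<lambda>t::real. 1 / (1 + t\<^sup>2))"
  using integrable_inverse_1_plus_square by (simp add: set_integrable_def inverse_eq_divide)

lemma integrable_of_weighted_norm:
  fixes g :: "real \<Rightarrow> complex"
  assumes [measurable]: "g \<in> borel_measurable borel"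
    and int: "integrable lborel (\<lambda>t. (1 + \<bar>t\<bar>) ^ n * cmod (g t))"
  shows "integrable lborel g"
proof (rule Bochner_Integration.integrable_bound[OF int])
  show "AE t in lborel. cmod (g t) \<le> norm ((1 + \<bar>t\<bar>) ^ n * cmod (g t))"
  proof (rule AE_I2)
    fix t :: real
    have "1 * cmod (g t) \<le> (1 + \<bar>t\<bar>) ^ n * cmod (g t)"
      by (intro mult_right_mono one_le_power) auto
    then show "cmod (g t) \<le> norm ((1 + \<bar>t\<bar>) ^ n * cmod (g t))" by simp
  qed
qed measurable

text \<open>The window \<open>{y - 1<..y + 1}\<close> contains the range \<open>{-1/2..1/2}\<close>
  of the law when \<open>\<bar>y\<bar> < 1/2\<close> and misses it when
  \<open>2 \<le> \<bar>y\<bar>\<close>. The weighted integrability of \<open>g\<close> later pays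
  for frequency shifts of size proportional to \<open>t\<close>.\<close>

lemma exists_bump_Fourier_integral:
  obtains \<psi> :: "real \<Rightarrow> real" and g :: "real \<Rightarrow> complex" where
    "\<psi> \<in> borel_measurable borel" "\<And>y. 0 \<le> \<psi> y" "\<And>y. \<psi> y \<le> 1"
    "\<And>y. \<bar>y\<bar> < 1/2 \<Longrightarrow> \<psi> y = 1" "\<And>y. 2 \<le> \<bar>y\<bar> \<Longrightarrow> \<psi> y = 0"
    "g \<in> borel_measurable borel"
    "integrable lborel (\<lambda>t. (1 + \<bar>t\<bar>) ^ n * cmod (g t))"
    "\<And>y. complex_of_real (\<psi> y) = (CLBINT t. g t * iexp (- (t * y)))"
proof -
  \<comment> \<open>Decay of order \<open>n + 2\<close>: \<open>n\<close> powers absorb the weight,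
    and two more leave the integrable majorant \<open>1 / (1 + t\<^sup>2)\<close>.\<close>
  obtain M C where M: "real_distribution M" and supp: "AE x in M. \<bar>x\<bar> \<le> 1/2"
    and atom: "\<And>a. AE x in M. x \<noteq> a"
    and C: "\<And>t. cmod (char M t) * \<bar>t\<bar> ^ Suc (Suc n) \<le> C"
    using exists_distribution_char_decay[of "1/2" "Suc n"] by auto
  interpret M: real_distribution M by (rule M)
  define \<psi> where "\<psi> y = measure M {y - 1<..y + 1}" for y
  \<comment> \<open>For \<open>t \<noteq> 0\<close> this is \<open>2 * sin t / t\<close>, the
    Fourier transform of the indicator of the window around \<open>0\<close>. At
    \<open>t = 0\<close> division by zero gives \<open>0\<close>, a change on a null set.\<close>
  define h where "h t = (iexp t - iexp (-t)) / (\<i> * t)" for t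
  define g where "g t = 1 / (2 * pi) * h t * char M t" for t
  have h_meas[measurable]: "h \<in> borel_measurable borel"
    unfolding h_def by measurable
  have g_meas[measurable]: "g \<in> borel_measurable borel"
    unfolding g_def by measurable
  have h_bound: "cmod (h t) \<le> 2" for t
    using Levy_Inversion_aux2[of "-1" 1 t] by (cases "t = 0") (auto simp: h_def)
  have g_bound: "cmod (g t) \<le> cmod (char M t)" for t
  proof -
    have "cmod (g t) = (1 / (2 * pi) * cmod (h t)) * cmod (char M t)"
      by (simp add: g_def norm_mult norm_divide)
    also have "\<dots> \<le> 1 * cmod (char M t)"
      using h_bound[of t] pi_gt3 by (intro mult_right_mono) (auto simp: field_simps)
    finally show ?thesis by simp
  qed
  have C0: "0 \<le> C" using C[of 0] by simp
  \<comment> \<open>For \<open>\<bar>t\<bar> \<le> 1\<close> every factor is bounded trivially.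
    Beyond that, \<open>1 + \<bar>t\<bar>\<close> and \<open>1 + t\<^sup>2\<close> are at most twice
    their leading terms, which produces exactly the power controlled by \<open>C\<close>.\<close>
  have bound: "(1 + \<bar>t\<bar>) ^ n * cmod (g t) \<le> 2 ^ Suc n * (1 + C) * (1 / (1 + t\<^sup>2))" for t
  proof -
    let ?c = "cmod (char M t)"
    have c1: "?c \<le> 1" by (rule M.cmod_char_le_1)
    have "(1 + \<bar>t\<bar>) ^ n * ?c * (1 + t\<^sup>2) \<le> 2 ^ Suc n * (1 + C)"
    proof (cases "\<bar>t\<bar> \<le> 1")
      case True
      have "(1 + \<bar>t\<bar>) ^ n * ?c * (1 + t\<^sup>2) \<le> 2 ^ n * 1 * 2"
        using True c1 abs_square_le_1[of t] by (intro mult_mono power_mono) auto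
      also have "\<dots> \<le> 2 ^ Suc n * (1 + C)" using C0 by simp
      finally show ?thesis .
    next
      case False
      have "(1 + \<bar>t\<bar>) ^ n * ?c * (1 + t\<^sup>2) \<le> (2 * \<bar>t\<bar>) ^ n * ?c * (2 * \<bar>t\<bar>\<^sup>2)"
        using False one_le_power[of "\<bar>t\<bar>" 2] by (intro mult_mono power_mono) auto
      also have "\<dots> = 2 ^ Suc n * (?c * \<bar>t\<bar> ^ Suc (Suc n))"
        by (simp add: power_mult_distrib power2_eq_square)
      also have "\<dots> \<le> 2 ^ Suc n * (1 + C)"
        using C[of t] by (intro mult_left_mono) auto
      finally show ?thesis .
    qed
    then have "(1 + \<bar>t\<bar>) ^ n * ?c \<le> 2 ^ Suc n * (1 + C) * (1 / (1 + t\<^sup>2))"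
      by (simp add: field_simps add_pos_nonneg)
    moreover have "(1 + \<bar>t\<bar>) ^ n * cmod (g t) \<le> (1 + \<bar>t\<bar>) ^ n * ?c"
      by (intro mult_left_mono g_bound) auto
    ultimately show ?thesis by linarith
  qed
  have int: "integrable lborel (\<lambda>t. (1 + \<bar>t\<bar>) ^ n * cmod (g t))"
  proof (rule Bochner_Integration.integrable_bound)
    show "integrable lborel (\<lambda>t::real. 2 ^ Suc n * (1 + C) * (1 / (1 + t\<^sup>2)))"
      using integrable_one_over_one_plus_square by (intro integrable_mult_right) auto
    show "AE t in lborel. norm ((1 + \<bar>t\<bar>) ^ n * cmod (g t)) \<le> norm (2 ^ Suc n * (1 + C) * (1 / (1 + t\<^sup>2)))"
      using bound C0 by (auto simp: abs_mult)
  qed measurable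
  have g_int: "integrable lborel g"
    by (rule integrable_of_weighted_norm[OF g_meas int])
  have inv: "complex_of_real (\<psi> y) = (CLBINT t. g t * iexp (- (t * y)))" for y
  proof -
    let ?G = "\<lambda>t. g t * iexp (- (t * y))"
    have G_int: "integrable lborel ?G"
      by (rule Bochner_Integration.integrable_bound[OF g_int]) (auto simp: norm_mult)
    have null: "measure M {a} = 0" for a
      using atom[of a] by (subst M.prob_eq_0) auto
    \<comment> \<open>The midpoint \<open>y\<close> of the window contributes only the phase
      \<open>iexp (- (t * y))\<close>, so the truncated integrand of Levy's formula is
      \<open>?G\<close> up to the factor \<open>2 * pi\<close>.\<close>
    have eq: "1 / (2 * pi) * (CLBINT t=-real T..real T. (iexp (-(t * (y - 1))) - iexp (-(t * (y + 1)))) / (\<i> * t) * char M t)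
        = (CLBINT t. indicator {-real T<..<real T} t *\<^sub>R ?G t)" for T :: nat
    proof -
      have "(iexp (-(t * (y - 1))) - iexp (-(t * (y + 1)))) / (\<i> * t) * char M t
          = (2 * pi) * ?G t" for t
      proof -
        have "iexp (-(t * (y - 1))) - iexp (-(t * (y + 1))) = (iexp t - iexp (-t)) * iexp (- (t * y))"
          by (simp add: algebra_simps exp_add[symmetric])
        then show ?thesis by (simp add: g_def h_def)
      qed
      then have "(CLBINT t=-real T..real T. (iexp (-(t * (y - 1))) - iexp (-(t * (y + 1)))) / (\<i> * t) * char M t)
          = (CLBINT t:{-real T<..<real T}. (2 * pi) * ?G t)"
        by (simp add: interval_lebesgue_integral_def)
      also have "\<dots> = (2 * pi) * (CLBINT t:{-real T<..<real T}. ?G t)"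
        by (rule set_integral_mult_right)
      finally show ?thesis by (simp add: set_lebesgue_integral_def)
    qed
    \<comment> \<open>Levy's formula gives a limit of truncated integrals; integrability of
      \<open>g\<close> identifies that limit with the full Lebesgue integral.\<close>
    have "(\<lambda>n. CLBINT t. indicator {-real n<..<real n} t *\<^sub>R ?G t) \<longlonglongrightarrow> (CLBINT t. ?G t)"
    proof (rule integral_dominated_convergence[where w="\<lambda>t. cmod (g t)"])
      show "AE t in lborel. (\<lambda>n. indicator {-real n<..<real n} t *\<^sub>R ?G t) \<longlonglongrightarrow> ?G t"
      proof (rule AE_I2, rule tendsto_eventually)
        fix t :: real
        obtain N where "\<bar>t\<bar> < real N" using reals_Archimedean2 by blast
        then show "\<forall>\<^sub>F n in sequentially. indicator {-real n<..<real n} t *\<^sub>R ?G t = ?G t"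
          by (intro eventually_sequentiallyI[of N]) (auto simp: indicator_def)
      qed
      show "AE t in lborel. norm (indicator {-real n<..<real n} t *\<^sub>R ?G t) \<le> cmod (g t)" for n
        by (auto simp: norm_mult indicator_def)
      show "integrable lborel (\<lambda>t. cmod (g t))" using g_int by simp
    qed measurable
    moreover have "(\<lambda>n. CLBINT t. indicator {-real n<..<real n} t *\<^sub>R ?G t) \<longlonglongrightarrow> complex_of_real (\<psi> y)"
    proof -
      have "y - 1 \<le> y + 1" by simp
      from M.Levy_Inversion[OF this null null] show ?thesis
        unfolding of_int_minus of_int_of_nat_eq eq \<psi>_def .
    qed
    ultimately show ?thesis using LIMSEQ_unique by blast
  qed
  \<comment> \<open>Measurability of \<open>\<psi>\<close> comes from writing it as a difference of
    translates of a monotone distribution function.\<close>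
  have "mono (cdf M)" by (auto intro!: monoI M.cdf_nondecreasing)
  then have [measurable]: "cdf M \<in> borel_measurable borel" by (rule borel_measurable_mono)
  have "\<psi> = (\<lambda>y. cdf M (y + 1) - cdf M (y - 1))"
    by (rule ext) (simp add: \<psi>_def M.cdf_diff_eq)
  then have meas: "\<psi> \<in> borel_measurable borel" by simp
  have one: "\<psi> y = 1" if "\<bar>y\<bar> < 1/2" for y
    unfolding \<psi>_def using supp that by (subst M.prob_eq_1) (auto elim!: eventually_mono)
  have zero: "\<psi> y = 0" if "2 \<le> \<bar>y\<bar>" for y
    unfolding \<psi>_def using supp that by (subst M.prob_eq_0) (auto elim!: eventually_mono)
  show ?thesis
  proof (rule that)
    show "0 \<le> \<psi> y" "\<psi> y \<le> 1" for y by (simp_all add: \<psi>_def)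
  qed (fact meas one zero g_meas int inv)+
qed

section \<open>Stability of Fourier decay under multiplication by a bump\<close>

text \<open>Inserting the integral for \<open>\<psi>\<close> writes the new transform as a
  \<open>g\<close>-weighted integral over \<open>t\<close> of the old one at
  \<open>\<xi> + t *\<^sub>R w\<close>. Such a shift costs at most a constant times
  \<open>(1 + \<bar>t\<bar>) ^ n\<close>, which the weighted integrability of \<open>g\<close>
  absorbs.\<close>

lemma fourier_decay_density:
  fixes \<mu> :: "'a::euclidean_space measure" and v :: 'a
  assumes fin: "finite_measure \<mu>" and sets: "sets \<mu> = sets borel"
    and decay: "fourier_decay \<mu> s" and s: "0 \<le> s" "s \<le> real n"
    and \<psi>: "\<psi> \<in> borel_measurable borel" "\<And>y. 0 \<le> \<psi> y"
    and g: "g \<in> borel_measurable borel" "integrable lborel (\<lambda>t. (1 + \<bar>t\<bar>) ^ n * cmod (g t))"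
    and inv: "\<And>y. complex_of_real (\<psi> y) = (CLBINT t. g t * iexp (- (t * y)))"
  shows "fourier_decay (density \<mu> (\<lambda>x. ennreal (\<psi> (x \<bullet> v - c)))) s"
proof -
  interpret finite_measure \<mu> by (rule fin)
  interpret P: pair_sigma_finite \<mu> lborel ..
  note [measurable_cong] = sets
  note [measurable] = \<psi>(1) g(1)
  define e where "e \<xi> x = exp (- 2 * complex_of_real pi * \<i> * complex_of_real (\<xi> \<bullet> x))" for \<xi> x :: 'a
  have e_meas[measurable]: "e \<xi> \<in> borel_measurable borel" for \<xi>
    unfolding e_def by (intro borel_measurable_continuous_onI continuous_intros)
  have e_norm[simp]: "cmod (e \<xi> x) = 1" for \<xi> x
    unfolding e_def by (simp add: norm_exp_eq_Re)
  \<comment> \<open>The factor \<open>1 / (2 * pi)\<close> reconciles the phase \<open>iexp\<close>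
    in the formula for \<open>\<psi>\<close> with the factor \<open>2 * pi\<close> in the Fourier
    transform.\<close>
  define w where "w = (1 / (2 * pi)) *\<^sub>R v"
  have e_shift: "iexp (- (t * (x \<bullet> v - c))) * e \<xi> x = iexp (t * c) * e (\<xi> + t *\<^sub>R w) x" for t x \<xi>
  proof -
    have "complex_of_real pi * complex_of_real (t * (v \<bullet> x) / (2 * pi)) = complex_of_real (t * (v \<bullet> x) / 2)"
      by (simp add: field_simps)
    then show ?thesis
      by (simp add: e_def w_def exp_add[symmetric] inner_add_left inner_commute[of x v] algebra_simps)
  qed
  have g_int: "integrable lborel g"
    by (rule integrable_of_weighted_norm[OF g])
  have FT: "fourier_transform \<mu> \<xi> = (LINT x|\<mu>. e \<xi> x)" for \<xi>
    unfolding fourier_transform_def e_def ..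
  \<comment> \<open>Both phases have modulus one, so the integrand has modulus
    \<open>cmod (g t)\<close>, which is integrable because \<open>\<mu>\<close> is finite. This
    justifies Fubini.\<close>
  have joint: "integrable (\<mu> \<Otimes>\<^sub>M lborel) (\<lambda>(x, t). g t * iexp (- (t * (x \<bullet> v - c))) * e \<xi> x)" for \<xi>
  proof (rule P.Fubini_integrable)
    show "integrable \<mu> (\<lambda>x. LBINT t. norm (case (x, t) of (x, t) \<Rightarrow> g t * iexp (- (t * (x \<bullet> v - c))) * e \<xi> x))"
      by (simp add: norm_mult)
    show "AE x in \<mu>. integrable lborel (\<lambda>t. case (x, t) of (x, t) \<Rightarrow> g t * iexp (- (t * (x \<bullet> v - c))) * e \<xi> x)"
    proof (rule AE_I2)
      fix x
      show "integrable lborel (\<lambda>t. case (x, t) of (x, t) \<Rightarrow> g t * iexp (- (t * (x \<bullet> v - c))) * e \<xi> x)"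
        by (rule Bochner_Integration.integrable_bound[OF g_int]) (auto simp: norm_mult)
    qed
  qed measurable
  have swap_eq: "(LINT x|\<mu>. g t * iexp (- (t * (x \<bullet> v - c))) * e \<xi> x)
      = g t * (iexp (t * c) * fourier_transform \<mu> (\<xi> + t *\<^sub>R w))" for t \<xi>
    unfolding mult.assoc e_shift FT by simp
  have FT_dens: "fourier_transform (density \<mu> (\<lambda>x. ennreal (\<psi> (x \<bullet> v - c)))) \<xi>
      = (CLBINT t. g t * (iexp (t * c) * fourier_transform \<mu> (\<xi> + t *\<^sub>R w)))" (is "?l = ?r")
    and int_conv: "integrable lborel (\<lambda>t. g t * (iexp (t * c) * fourier_transform \<mu> (\<xi> + t *\<^sub>R w)))" for \<xi>
  proof -
    have "?l = (LINT x|\<mu>. \<psi> (x \<bullet> v - c) *\<^sub>R e \<xi> x)"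
      unfolding fourier_transform_def e_def[symmetric] using \<psi>(2) by (subst integral_density) auto
    also have "\<dots> = (LINT x|\<mu>. (CLBINT t. g t * iexp (- (t * (x \<bullet> v - c))) * e \<xi> x))"
      by (simp add: scaleR_conv_of_real inv)
    also have "\<dots> = (CLBINT t. (LINT x|\<mu>. g t * iexp (- (t * (x \<bullet> v - c))) * e \<xi> x))"
      by (rule P.Fubini_integral[OF joint, symmetric])
    also have "\<dots> = ?r" unfolding swap_eq ..
    finally show "?l = ?r" .
    show "integrable lborel (\<lambda>t. g t * (iexp (t * c) * fourier_transform \<mu> (\<xi> + t *\<^sub>R w)))"
      using P.integrable_snd[OF joint[of \<xi>]] unfolding swap_eq .
  qed
  define m where "m = measure \<mu> (space \<mu>)"
  have FT_le: "cmod (fourier_transform \<mu> \<eta>) \<le> m" for \<eta>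
    unfolding FT m_def using integral_norm_bound[of \<mu> "e \<eta>"] by simp
  obtain C' where C': "\<And>\<eta>. \<eta> \<noteq> 0 \<Longrightarrow> cmod (fourier_transform \<mu> \<eta>) \<le> C' * norm \<eta> powr (- s / 2)"
    using decay unfolding fourier_decay_def by blast
  define C where "C = max C' 0"
  have C: "cmod (fourier_transform \<mu> \<eta>) \<le> C * norm \<eta> powr (- s / 2)" if "\<eta> \<noteq> 0" for \<eta>
    using C'[OF that] mult_right_mono[of C' C "norm \<eta> powr (- s / 2)"] by (simp add: C_def)
  have C0: "0 \<le> C" by (simp add: C_def)
  have m0: "0 \<le> m" by (simp add: m_def)
  \<comment> \<open>The first summand serves the case where the decay of \<open>\<mu>\<close> is
    used, the second the case where only its total mass \<open>m\<close> is.\<close>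
  define K where "K = C * 2 ^ n + m * (1 + 2 * norm w) ^ n"
  have pw: "a powr (s / 2) \<le> b ^ n" if "0 \<le> a" "a \<le> b" "1 \<le> b" for a b :: real
  proof -
    have "a powr (s / 2) \<le> b powr (s / 2)" using that s by (intro powr_mono2) auto
    also have "\<dots> \<le> b powr real n" using that s by (intro powr_mono) auto
    also have "\<dots> = b ^ n" using that by (simp add: powr_realpow)
    finally show ?thesis .
  qed
  have bound: "cmod (fourier_transform \<mu> (\<xi> + t *\<^sub>R w)) \<le> K * (1 + \<bar>t\<bar>) ^ n * norm \<xi> powr (- s / 2)"
    if \<xi>: "\<xi> \<noteq> 0" for \<xi> t
  proof -
    define \<eta> where "\<eta> = \<xi> + t *\<^sub>R w"
    have tri: "norm \<xi> \<le> norm \<eta> + \<bar>t\<bar> * norm w"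
      using norm_triangle_ineq4[of \<eta> "t *\<^sub>R w"] by (simp add: \<eta>_def)
    have one: "1 \<le> (1 + \<bar>t\<bar>) ^ n" by (intro one_le_power) auto
    \<comment> \<open>If \<open>\<eta>\<close> is at least half as long as \<open>\<xi>\<close>, it
      is nonzero and the decay at \<open>\<eta>\<close> transfers to \<open>\<xi>\<close>. Otherwise
      the shift makes up more than half of \<open>\<xi>\<close>, so a power of
      \<open>1 + \<bar>t\<bar>\<close> compensates for the trivial bound \<open>m\<close>.\<close>
    have "norm \<xi> powr (s / 2) * cmod (fourier_transform \<mu> \<eta>) \<le> K * (1 + \<bar>t\<bar>) ^ n"
    proof (cases "norm \<xi> \<le> 2 * norm \<eta>")
      case True
      then have \<eta>: "\<eta> \<noteq> 0" using \<xi> by auto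
      have "norm \<xi> powr (s / 2) * cmod (fourier_transform \<mu> \<eta>)
          \<le> (2 * norm \<eta>) powr (s / 2) * (C * norm \<eta> powr (- s / 2))"
        using True s C[OF \<eta>] by (intro mult_mono powr_mono2) auto
      also have "\<dots> = C * 2 powr (s / 2)"
        using \<eta> by (simp add: powr_mult powr_minus field_simps)
      also have "\<dots> \<le> C * 2 ^ n"
        using C0 by (intro mult_left_mono pw) auto
      also have "\<dots> \<le> K" using m0 by (simp add: K_def)
      also have "\<dots> \<le> K * (1 + \<bar>t\<bar>) ^ n"
        using mult_left_mono[OF one, of K] C0 m0 by (simp add: K_def)
      finally show ?thesis .
    next
      case False
      with tri have "norm \<xi> \<le> 2 * norm w * \<bar>t\<bar>" by (simp add: algebra_simps)
      also have "\<dots> \<le> (1 + 2 * norm w) * (1 + \<bar>t\<bar>)" by (intro mult_mono) auto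
      finally have le: "norm \<xi> \<le> (1 + 2 * norm w) * (1 + \<bar>t\<bar>)" .
      have ge1: "1 \<le> (1 + 2 * norm w) * (1 + \<bar>t\<bar>)"
        using mult_mono[of 1 "1 + 2 * norm w" 1 "1 + \<bar>t\<bar>"] by simp
      have "norm \<xi> powr (s / 2) * cmod (fourier_transform \<mu> \<eta>)
          \<le> ((1 + 2 * norm w) * (1 + \<bar>t\<bar>)) ^ n * m"
        using le ge1 FT_le by (intro mult_mono pw) auto
      also have "\<dots> = m * (1 + 2 * norm w) ^ n * (1 + \<bar>t\<bar>) ^ n"
        by (simp add: power_mult_distrib)
      also have "\<dots> \<le> K * (1 + \<bar>t\<bar>) ^ n"
        using C0 by (intro mult_right_mono) (auto simp: K_def)
      finally show ?thesis .
    qed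
    then show ?thesis
      using \<xi> by (simp add: \<eta>_def powr_minus field_simps)
  qed
  show ?thesis
    unfolding fourier_decay_def
  proof (intro exI allI impI)
    fix \<xi> :: 'a assume \<xi>: "\<xi> \<noteq> 0"
    let ?F = "\<lambda>t. g t * (iexp (t * c) * fourier_transform \<mu> (\<xi> + t *\<^sub>R w))"
    let ?p = "norm \<xi> powr (- s / 2)"
    have "cmod (CLBINT t. ?F t) \<le> (LBINT t. (1 + \<bar>t\<bar>) ^ n * cmod (g t) * (K * ?p))"
    proof (rule Bochner_Integration.integral_norm_bound_integral[OF int_conv])
      show "integrable lborel (\<lambda>t. (1 + \<bar>t\<bar>) ^ n * cmod (g t) * (K * ?p))"
        using g(2) by (rule integrable_mult_left)
      fix t :: real
      have "cmod (?F t) \<le> cmod (g t) * (K * (1 + \<bar>t\<bar>) ^ n * ?p)"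
        using mult_left_mono[OF bound[OF \<xi>, of t], of "cmod (g t)"] by (simp add: norm_mult)
      then show "cmod (?F t) \<le> (1 + \<bar>t\<bar>) ^ n * cmod (g t) * (K * ?p)"
        by (simp add: mult_ac)
    qed
    also have "\<dots> = (LBINT t. (1 + \<bar>t\<bar>) ^ n * cmod (g t)) * (K * ?p)" by simp
    finally show "cmod (fourier_transform (density \<mu> (\<lambda>x. ennreal (\<psi> (x \<bullet> v - c)))) \<xi>)
        \<le> (LBINT t. (1 + \<bar>t\<bar>) ^ n * cmod (g t)) * K * ?p"
      unfolding FT_dens by (simp only: mult.assoc)
  qed
qed

lemma (in finite_measure) finite_measure_density_le_one:
  assumes [measurable]: "f \<in> borel_measurable M" and "\<And>x. f x \<le> 1"
  shows "finite_measure (density M f)"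
proof
  have "emeasure (density M f) (space (density M f)) = (\<integral>\<^sup>+x. f x \<partial>M)"
    by (simp add: emeasure_density cong: nn_integral_cong)
  also have "\<dots> \<le> (\<integral>\<^sup>+x. 1 \<partial>M)" using assms(2) by (intro nn_integral_mono)
  also have "\<dots> < \<infinity>" by (simp add: less_top[symmetric])
  finally show "emeasure (density M f) (space (density M f)) \<noteq> \<infinity>" by simp
qed

text \<open>A product of one-dimensional bumps, one per coordinate, multiplies the measure by
  functions of a single inner product in turn. The same \<open>\<phi>\<close> serves all
  \<open>\<mu>\<close> and \<open>s\<close>, since its order of smoothness is tied to
  \<open>DIM('a)\<close> and not to \<open>s\<close>.\<close>

lemma exists_bump_preserving_decay:
  fixes x :: "'a::euclidean_space"
  assumes R: "0 < R"
  obtains \<phi> \<delta> where "\<phi> \<in> borel_measurable borel" "\<And>y. 0 \<le> \<phi> y" "\<And>y. \<phi> y \<le> 1"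
    "0 < \<delta>" "\<And>y. dist x y < \<delta> \<Longrightarrow> \<phi> y = (1::real)" "\<And>y. R \<le> dist x y \<Longrightarrow> \<phi> y = 0"
    "\<And>\<mu> s. \<lbrakk>finite_measure \<mu>; sets \<mu> = sets borel; 0 \<le> s; s \<le> real DIM('a); fourier_decay \<mu> s\<rbrakk>
       \<Longrightarrow> fourier_decay (density \<mu> (\<lambda>x. ennreal (\<phi> x))) s"
proof -
  obtain \<psi> :: "real \<Rightarrow> real" and g :: "real \<Rightarrow> complex" where
    \<psi>[measurable]: "\<psi> \<in> borel_measurable borel" and \<psi>0: "\<And>y. 0 \<le> \<psi> y" and \<psi>1: "\<And>y. \<psi> y \<le> 1"
    and near: "\<And>y. \<bar>y\<bar> < 1/2 \<Longrightarrow> \<psi> y = 1" and far: "\<And>y. 2 \<le> \<bar>y\<bar> \<Longrightarrow> \<psi> y = 0"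
    and g: "g \<in> borel_measurable borel"
      "integrable lborel (\<lambda>t. (1 + \<bar>t\<bar>) ^ DIM('a) * cmod (g t))"
      "\<And>y. complex_of_real (\<psi> y) = (CLBINT t. g t * iexp (- (t * y)))"
    using exists_bump_Fourier_integral[of "DIM('a)"] by blast
  \<comment> \<open>Where the product is nonzero every coordinate of \<open>y - x\<close> is at most
    \<open>2 * r\<close> in size, so the l1 bound gives
    \<open>norm (y - x) \<le> 2 * r * DIM('a)\<close>; the \<open>+ 1\<close> makes this strictly
    less than \<open>R\<close>.\<close>
  define r where "r = R / (2 * real DIM('a) + 1)"
  have r: "0 < r" using R by (simp add: r_def add_pos_pos)
  define f where "f b y = \<psi> (y \<bullet> (b /\<^sub>R r) - (x \<bullet> b) / r)" for b y :: 'a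
  define \<phi> where "\<phi> y = (\<Prod>b\<in>Basis. f b y)" for y :: 'a
  have f_meas[measurable]: "f b \<in> borel_measurable borel" for b
    unfolding f_def by measurable
  have f_eq: "f b y = \<psi> ((y - x) \<bullet> b / r)" for b y
    by (simp add: f_def inner_diff_left field_simps diff_divide_distrib)
  have f0: "0 \<le> f b y" and f1: "f b y \<le> 1" for b y by (auto simp: f_def \<psi>0 \<psi>1)
  \<comment> \<open>Induction over partial products: factors bounded by \<open>1\<close> keep each
    intermediate measure finite, so the next coordinate factor can be applied to it.\<close>
  have "fourier_decay (density \<mu> (\<lambda>y. ennreal (\<Prod>b\<in>B. f b y))) s"
    if \<mu>: "finite_measure \<mu>" "sets \<mu> = sets borel" "0 \<le> s" "s \<le> real DIM('a)" "fourier_decay \<mu> s"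
      and "finite B" for \<mu> :: "'a measure" and s B
    using \<open>finite B\<close>
  proof (induction B)
    case empty
    then show ?case using \<mu> by (simp add: density_1)
  next
    case (insert b B)
    note [measurable_cong] = \<mu>(2)
    let ?\<nu> = "density \<mu> (\<lambda>y. ennreal (\<Prod>b\<in>B. f b y))"
    have "finite_measure ?\<nu>"
      using f0 f1 by (intro finite_measure.finite_measure_density_le_one[OF \<mu>(1)])
        (auto intro!: prod_le_1)
    then have "fourier_decay (density ?\<nu> (\<lambda>y. ennreal (f b y))) s"
      unfolding f_def using insert.IH \<mu> \<psi> \<psi>0 g
      by (intro fourier_decay_density[where n="DIM('a)" and g=g]) (auto simp: f_def)
    also have "density ?\<nu> (\<lambda>y. ennreal (f b y)) =
        density \<mu> (\<lambda>y. ennreal (\<Prod>b\<in>insert b B. f b y))"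
      using insert.hyps f0
      by (subst density_density_eq) (auto simp: ennreal_mult' mult.commute prod_nonneg)
    finally show ?case .
  qed
  then have decay: "fourier_decay (density \<mu> (\<lambda>y. ennreal (\<phi> y))) s"
    if "finite_measure \<mu>" "sets \<mu> = sets borel" "0 \<le> s" "s \<le> real DIM('a)" "fourier_decay \<mu> s"
    for \<mu> :: "'a measure" and s
    unfolding \<phi>_def using that by simp
  have one: "\<phi> y = 1" if "dist x y < r / 2" for y
    unfolding \<phi>_def
  proof (rule prod.neutral, rule ballI)
    fix b :: 'a assume "b \<in> Basis"
    then have "\<bar>(y - x) \<bullet> b\<bar> < r / 2"
      using Basis_le_norm[of b "y - x"] that by (simp add: dist_norm norm_minus_commute)
    then show "f b y = 1" unfolding f_eq using r by (intro near) (simp add: field_simps)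
  qed
  have zero: "\<phi> y = 0" if "R \<le> dist x y" for y
  proof (rule ccontr)
    assume "\<phi> y \<noteq> 0"
    then have "f b y \<noteq> 0" if "b \<in> Basis" for b using that by (auto simp: \<phi>_def)
    then have "\<not> 2 \<le> \<bar>(y - x) \<bullet> b / r\<bar>" if "b \<in> Basis" for b
      using far that unfolding f_eq by blast
    then have small: "\<bar>(y - x) \<bullet> b\<bar> \<le> 2 * r" if "b \<in> Basis" for b
      using that r by (fastforce simp: abs_divide field_simps)
    have "norm (y - x) \<le> (\<Sum>b\<in>Basis. \<bar>(y - x) \<bullet> b\<bar>)" by (rule norm_le_l1)
    also have "\<dots> \<le> real DIM('a) * (2 * r)" using small by (intro sum_bounded_above) auto
    also have "\<dots> < (2 * real DIM('a) + 1) * r" using r by (simp add: algebra_simps)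
    also have "\<dots> = R"
    proof -
      have "2 * real DIM('a) + 1 \<noteq> 0" by linarith
      then show ?thesis
        unfolding r_def times_divide_eq_right by (rule nonzero_mult_div_cancel_left)
    qed
    finally show False using that by (simp add: dist_norm norm_minus_commute)
  qed
  show ?thesis
  proof (rule that[of \<phi> "r / 2"])
    show "\<phi> \<in> borel_measurable borel" unfolding \<phi>_def by measurable
    show "0 \<le> \<phi> y" "\<phi> y \<le> 1" for y using f0 f1 by (auto simp: \<phi>_def intro!: prod_nonneg prod_le_1)
  qed (use r one zero decay in auto)
qed

section \<open>Localising a measure to an open set\<close>

text \<open>By the Lindelof property the union of all open null sets is itself null, so it cannot
  cover a set of positive measure.\<close>

lemma exists_point_of_support:
  fixes U :: "'a::second_countable_topology set"
  assumes sets: "sets \<mu> = sets borel" and U: "open U" "emeasure \<mu> U > 0"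
  obtains x where "x \<in> U" "\<And>V. open V \<Longrightarrow> x \<in> V \<Longrightarrow> emeasure \<mu> V > 0"
proof (rule ccontr)
  assume "\<not> thesis"
  note point = that
  have no: "\<exists>V. open V \<and> x \<in> V \<and> emeasure \<mu> V = 0" if "x \<in> U" for x
  proof (rule ccontr)
    assume "\<not> ?thesis"
    then have "emeasure \<mu> V > 0" if "open V" "x \<in> V" for V
      using that unfolding zero_less_iff_neq_zero by blast
    then have thesis by (rule point[OF \<open>x \<in> U\<close>])
    with \<open>\<not> thesis\<close> show False by contradiction
  qed
  define N where "N = {V. open V \<and> emeasure \<mu> V = 0}"
  obtain F where F: "F \<subseteq> N" "countable F" "\<Union>F = \<Union>N"
    by (rule Lindelof[of N]) (simp_all add: N_def)
  have "\<Union>F \<in> null_sets \<mu>"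
  proof -
    have "V \<in> null_sets \<mu>" if "V \<in> F" for V
      using that F(1) sets by (auto simp: N_def null_sets_def)
    then show ?thesis using null_sets_UN'[OF F(2), of "\<lambda>V. V" \<mu>] by simp
  qed
  moreover have "U \<subseteq> \<Union>F"
    using no unfolding F(3) N_def by blast
  ultimately have "U \<in> null_sets \<mu>"
    using null_sets_subset[of "\<Union>F" \<mu> U] sets U(1) by simp
  then show False using U by (simp add: null_sets_def)
qed

text \<open>Used to normalise a localised measure to mass one; only the decay constant is
  rescaled.\<close>

lemma fourier_decay_density_const:
  fixes \<mu> :: "'a::euclidean_space measure"
  assumes sets: "sets \<mu> = sets borel" and decay: "fourier_decay \<mu> s" and a: "0 \<le> a"
  shows "fourier_decay (density \<mu> (\<lambda>_. ennreal a)) s"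
proof -
  note [measurable_cong] = sets
  obtain C where C: "\<And>\<xi>. \<xi> \<noteq> 0 \<Longrightarrow> cmod (fourier_transform \<mu> \<xi>) \<le> C * norm \<xi> powr (- s / 2)"
    using decay unfolding fourier_decay_def by blast
  have meas: "(\<lambda>x. exp (- 2 * complex_of_real pi * \<i> * complex_of_real (\<xi> \<bullet> x))) \<in> borel_measurable \<mu>" for \<xi>
    unfolding measurable_cong_sets[OF sets refl]
    by (intro borel_measurable_continuous_onI continuous_intros)
  have "fourier_transform (density \<mu> (\<lambda>_. ennreal a)) \<xi> = a *\<^sub>R fourier_transform \<mu> \<xi>" for \<xi>
    unfolding fourier_transform_def using a by (subst integral_density[OF meas]) auto
  then have "cmod (fourier_transform (density \<mu> (\<lambda>_. ennreal a)) \<xi>) \<le> (a * C) * norm \<xi> powr (- s / 2)"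
    if "\<xi> \<noteq> 0" for \<xi>
    using mult_left_mono[OF C[OF that] a] a by (simp add: mult.assoc)
  then show ?thesis unfolding fourier_decay_def by blast
qed

text \<open>A bump around a support point of \<open>\<mu>\<close> in \<open>U\<close>, vanishing
  outside a ball inside \<open>U\<close>, cuts out a nonzero piece of \<open>\<mu>\<close> carried
  by \<open>B\<close>. Once normalised, it competes in the supremum defining
  \<open>fourier_dim B\<close>.\<close>

lemma fourier_dim_ge_of_open_part:
  fixes \<mu> :: "'a::euclidean_space measure"
  assumes prob: "prob_space \<mu>" and sets: "sets \<mu> = sets borel"
    and U: "open U" "emeasure \<mu> U > 0" and B: "B \<in> sets borel"
    and conc: "AE x in \<mu>. x \<in> U \<longrightarrow> x \<in> B"
  shows "fourier_dim_measure \<mu> \<le> fourier_dim B"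
proof -
  interpret prob_space \<mu> by (rule prob)
  note [measurable_cong] = sets
  obtain x where x: "x \<in> U" and supp: "\<And>V. open V \<Longrightarrow> x \<in> V \<Longrightarrow> emeasure \<mu> V > 0"
    using exists_point_of_support[OF sets U] by blast
  obtain R where R: "0 < R" "ball x R \<subseteq> U" using x U by (meson open_contains_ball)
  obtain \<phi> \<delta> where \<phi>[measurable]: "\<phi> \<in> borel_measurable borel" and \<phi>0: "\<And>y. 0 \<le> \<phi> y"
    and \<phi>1: "\<And>y. \<phi> y \<le> 1"
    and \<delta>: "0 < \<delta>" "\<And>y. dist x y < \<delta> \<Longrightarrow> \<phi> y = (1::real)" and far: "\<And>y. R \<le> dist x y \<Longrightarrow> \<phi> y = 0"
    and decay: "\<And>\<mu> s. \<lbrakk>finite_measure \<mu>; sets \<mu> = sets borel; 0 \<le> s; s \<le> real DIM('a); fourier_decay \<mu> s\<rbrakk>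
       \<Longrightarrow> fourier_decay (density \<mu> (\<lambda>x. ennreal (\<phi> x))) s"
    using exists_bump_preserving_decay[OF R(1), of x] by blast
  define \<nu> where "\<nu> = density \<mu> (\<lambda>x. ennreal (\<phi> x))"
  interpret N: finite_measure \<nu>
    unfolding \<nu>_def using \<phi>1 by (intro finite_measure_density_le_one) auto
  have sets\<nu>[measurable_cong]: "sets \<nu> = sets borel" by (simp add: \<nu>_def sets)
  define Z where "Z = measure \<nu> (space \<nu>)"
  \<comment> \<open>The localised mass is positive because \<open>\<phi>\<close> equals
    \<open>1\<close> on a ball around a support point.\<close>
  have "0 < emeasure \<mu> (ball x \<delta>)" using \<delta> by (intro supp) auto
  also have "\<dots> = (\<integral>\<^sup>+y. indicator (ball x \<delta>) y \<partial>\<mu>)" by (simp add: sets)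
  also have "\<dots> \<le> (\<integral>\<^sup>+y. ennreal (\<phi> y) \<partial>\<mu>)"
    using \<delta>(2) by (intro nn_integral_mono) (auto simp: indicator_def)
  also have "\<dots> = emeasure \<nu> (space \<nu>)"
    unfolding \<nu>_def by (simp add: emeasure_density cong: nn_integral_cong)
  also have "\<dots> = ennreal Z" unfolding Z_def by (rule N.emeasure_eq_measure)
  finally have Z: "0 < Z" by simp
  define \<rho> where "\<rho> = density \<nu> (\<lambda>_. ennreal (1 / Z))"
  have "emeasure \<rho> (space \<rho>) = ennreal (1 / Z) * ennreal Z"
    unfolding \<rho>_def Z_def N.emeasure_eq_measure[symmetric]
    by (simp add: emeasure_density cong: nn_integral_cong)
  also have "\<dots> = 1" using Z by (simp add: ennreal_mult'[symmetric] ennreal_1[symmetric] del: ennreal_1)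
  finally have prob\<rho>: "prob_space \<rho>" by (rule prob_spaceI)
  then interpret Q: prob_space \<rho> .
  have sets\<rho>: "sets \<rho> = sets borel" by (simp add: \<rho>_def sets\<nu>)
  have "AE y in \<nu>. y \<in> B"
    unfolding \<nu>_def
  proof (subst AE_density)
    show "AE y in \<mu>. 0 < ennreal (\<phi> y) \<longrightarrow> y \<in> B"
      using conc
    proof eventually_elim
      case (elim y)
      show ?case
      proof
        assume "0 < ennreal (\<phi> y)"
        then have "y \<in> ball x R" using far[of y] by (cases "R \<le> dist x y") auto
        then show "y \<in> B" using elim R by auto
      qed
    qed
  qed simp
  then have "AE y in \<rho>. y \<in> B" unfolding \<rho>_def by (subst AE_density) auto
  then have "emeasure \<rho> B = 1"
    using Q.emeasure_eq_1_AE[of B] B sets\<rho> by simp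
  with sets\<rho> prob\<rho> have mem: "\<rho> \<in> borel_probs B" by (simp add: borel_probs_def)
  \<comment> \<open>The bump was fixed before \<open>s\<close>, so every exponent admissible for
    \<open>\<mu>\<close> is admissible for \<open>\<rho>\<close> and the two suprema
    compare.\<close>
  have "fourier_decay \<rho> s" if "0 \<le> s" "s \<le> real DIM('a)" "fourier_decay \<mu> s" for s
    unfolding \<rho>_def using Z sets\<nu> that sets finite_measure_axioms
    by (intro fourier_decay_density_const) (auto simp: \<nu>_def intro: decay)
  then have "fourier_dim_measure \<mu> \<le> fourier_dim_measure \<rho>"
    unfolding fourier_dim_measure_def by (intro SUP_subset_mono) auto
  also have "\<dots> \<le> fourier_dim B" unfolding fourier_dim_def by (rule SUP_upper[OF mem])
  finally show ?thesis .
qed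

section \<open>Monotonicity and countable unions\<close>

lemma fourier_dim_mono:
  fixes A B :: "'a::euclidean_space set"
  assumes "A \<subseteq> B" "B \<in> sets borel"
  shows "fourier_dim A \<le> fourier_dim B"
  unfolding fourier_dim_def
proof (intro SUP_subset_mono subsetI order.refl)
  fix \<mu> :: "'a measure" assume \<mu>: "\<mu> \<in> borel_probs A"
  then interpret prob_space \<mu> by (simp add: borel_probs_def)
  have "1 \<le> emeasure \<mu> B"
    using emeasure_mono[of A B \<mu>] assms \<mu> by (simp add: borel_probs_def)
  then show "\<mu> \<in> borel_probs B"
    using \<mu> measure_le_1 by (simp add: borel_probs_def antisym)
qed

theorem theorem2:
  fixes A :: "'i \<Rightarrow> 'a::euclidean_space set" and I :: "'i set"
  assumes "countable I"
    and "\<And>k. k \<in> I \<Longrightarrow> A k \<in> sets borel"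
    and "(SUP n\<in>I. modified_fourier_dim (A n \<inter> closure (\<Union>k\<in>I - {n}. A k)))
           < fourier_dim (\<Union>k\<in>I. A k)"
  shows "fourier_dim (\<Union>k\<in>I. A k) = (SUP k\<in>I. fourier_dim (A k))"
proof (rule antisym)
  let ?A = "\<Union>k\<in>I. A k"
  let ?E = "\<lambda>n. closure (\<Union>k\<in>I - {n}. A k)"
  let ?t = "SUP n\<in>I. modified_fourier_dim (A n \<inter> ?E n)"
  have A_meas: "?A \<in> sets borel" using assms(1,2) by (intro sets.countable_UN') auto
  show "(SUP k\<in>I. fourier_dim (A k)) \<le> fourier_dim ?A"
    by (intro SUP_least fourier_dim_mono A_meas) auto
  have large: "fourier_dim_measure \<mu> \<le> (SUP k\<in>I. fourier_dim (A k))"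
    if \<mu>: "\<mu> \<in> borel_probs ?A" and dim: "?t < fourier_dim_measure \<mu>" for \<mu>
  proof -
    have sets: "sets \<mu> = sets borel" and prob: "prob_space \<mu>" and full: "emeasure \<mu> ?A = 1"
      using \<mu> by (auto simp: borel_probs_def)
    interpret prob_space \<mu> by (rule prob)
    have "space \<mu> = UNIV" using sets_eq_imp_space_eq[OF sets] by simp
    then have univ: "\<mu> \<in> borel_probs UNIV"
      using sets prob emeasure_space_1 by (simp add: borel_probs_def)
    \<comment> \<open>If the set had positive mass, \<open>\<mu>\<close> would compete in its
      modified dimension and force \<open>fourier_dim_measure \<mu> \<le> ?t\<close>.\<close>
    have null: "A n \<inter> ?E n \<in> null_sets \<mu>" if n: "n \<in> I" for n
    proof (rule ccontr)
      assume "A n \<inter> ?E n \<notin> null_sets \<mu>"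
      then have "emeasure \<mu> (A n \<inter> ?E n) > 0"
        using assms(2)[OF n] sets by (auto simp: null_sets_def zero_less_iff_neq_zero)
      then have "fourier_dim_measure \<mu> \<le> modified_fourier_dim (A n \<inter> ?E n)"
        unfolding modified_fourier_dim_def using univ by (intro SUP_upper) auto
      also have "\<dots> \<le> ?t" using n by (intro SUP_upper)
      finally show False using dim by simp
    qed
    have "\<exists>n\<in>I. emeasure \<mu> (A n) \<noteq> 0"
    proof (rule ccontr)
      assume "\<not> ?thesis"
      then have "?A \<in> null_sets \<mu>"
        using assms(1,2) sets by (intro null_sets_UN') (auto simp: null_sets_def)
      then show False using full by (simp add: null_sets_def)
    qed
    then obtain n where n: "n \<in> I" "emeasure \<mu> (A n) \<noteq> 0" by blast
    \<comment> \<open>\<open>A n\<close> is covered by the null set \<open>A n \<inter> ?E n\<close>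
      and \<open>- ?E n\<close>, so the latter must carry the positive mass of
      \<open>A n\<close>.\<close>
    have "emeasure \<mu> (- ?E n) > 0"
    proof (rule ccontr)
      assume "\<not> ?thesis"
      then have "- ?E n \<in> null_sets \<mu>" using sets by (auto simp: null_sets_def)
      then have "A n \<inter> ?E n \<union> - ?E n \<in> null_sets \<mu>" using null[OF n(1)] by auto
      then have "A n \<in> null_sets \<mu>"
        using assms(2)[OF n(1)] sets by (auto elim!: null_sets_subset)
      then show False using n by (simp add: null_sets_def)
    qed
    \<comment> \<open>Outside the closure of the other sets, a point of the union can only come from
      \<open>A n\<close>.\<close>
    moreover have "AE x in \<mu>. x \<in> - ?E n \<longrightarrow> x \<in> A n"
    proof -
      have "AE x in \<mu>. x \<in> ?A"
        using full A_meas sets by (intro AE_prob_1) (simp add: measure_def)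
      then show ?thesis
      proof eventually_elim
        case (elim x)
        then show ?case using closure_subset[of "\<Union>k\<in>I - {n}. A k"] by auto
      qed
    qed
    ultimately have "fourier_dim_measure \<mu> \<le> fourier_dim (A n)"
      using prob sets assms(2)[OF n(1)] by (intro fourier_dim_ge_of_open_part) auto
    also have "\<dots> \<le> (SUP k\<in>I. fourier_dim (A k))" using n by (intro SUP_upper)
    finally show ?thesis .
  qed
  \<comment> \<open>Measures of dimension at most \<open>?t\<close> escape \<open>large\<close>; the
    strict hypothesis supplies one measure above \<open>?t\<close>, whose dimension bounds all of
    theirs.\<close>
  obtain \<mu>0 where \<mu>0: "\<mu>0 \<in> borel_probs ?A" "?t < fourier_dim_measure \<mu>0"
    using assms(3) unfolding fourier_dim_def[of ?A] less_SUP_iff by blast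
  show "fourier_dim ?A \<le> (SUP k\<in>I. fourier_dim (A k))"
    unfolding fourier_dim_def[of ?A]
  proof (rule SUP_least)
    fix \<mu> assume \<mu>: "\<mu> \<in> borel_probs ?A"
    show "fourier_dim_measure \<mu> \<le> (SUP k\<in>I. fourier_dim (A k))"
      using large[OF \<mu>] large[OF \<mu>0] \<mu>0(2) by (cases "?t < fourier_dim_measure \<mu>") auto
  qed
qed
end
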